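(* Let $n\ge2$, $k\ge1$, $i_1,\dots,i_k\in\{1,\dots,n-1\}$, $j\in\{1,\dots,k\}$, and fix integers $a_h$ for $h\ne j$. For $e\in\mathbb{Z}$ put $V_n(e)=V_n(x_{i_1}^{a_1}\cdots x_{i_j}^{e}\cdots x_{i_k}^{a_k})$ (the $j$-th exponent replaced by $e$). Then the sequence $(V_n(e))_{e\in\mathbb{Z}}$ contains at most two terms equal to $1$, and if $V_n(a)=V_n(b)=1$ with $a\ne b$ then $|a-b|=2$.
   Context: $\mathcal{B}_n$ is the Artin braid group with standard generators $x_1,\dots,x_{n-1}$; $V_n(\beta)$ is the Jones polynomial of the closure $\widehat\beta$, normalized by $V(\text{unknot})=1$ and $q^{-1}V_{L_+}-qV_{L_-}=(q^{1/2}-q^{-1/2})V_{L_0}$, written in $s=q^{-1/2}$. Conventions: closures of $\alpha x_i^{e+2}\gamma$, $\alpha x_i^{e+1}\gamma$, $\alpha x_i^{e}\gamma$ play the roles of $L_-,L_0,L_+$ (e.g. the closure of $x_1^2\in\mathcal B_2$ has Jones polynomial $-s-s^5$). *)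

theory Defs
  imports Main "HOL-Computational_Algebra.Formal_Laurent_Series"
begin

text \<open>Braid words.  A letter (i, True) stands for the generator x_i, a letter
  (i, False) for its inverse x_i^{-1}.  Strands are numbered 1..n and x_i
  crosses strands i and i+1.\<close>

type_synonym braid_word = "(nat \<times> bool) list"

definition sgn_letter :: "bool \<Rightarrow> int" where
  "sgn_letter b = (if b then 1 else -1)"

text \<open>The word of x_{i_1}^{a_1} ... x_{i_k}^{a_k}, given as the list of pairs (i_h, a_h).\<close>
definition braid_of_powers :: "(nat \<times> int) list \<Rightarrow> braid_word" where
  "braid_of_powers ps = concat (map (\<lambda>(i, a). replicate (nat \<bar>a\<bar>) (i, a > 0)) ps)"

text \<open>Kauffman bracket state sum on the closed braid diagram.  A state S is the
  set of positions t (crossing number t of the word) at which the crossing is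
  smoothed horizontally (the Temperley-Lieb element e_i); at all other positions
  it is smoothed vertically (identity).  The points of the diagram are (t, p):
  strand p just above crossing t; level m = length w is identified with level 0
  (braid closure).\<close>

definition closure_points :: "nat \<Rightarrow> braid_word \<Rightarrow> (nat \<times> nat) set" where
  "closure_points n w = {0..<max 1 (length w)} \<times> {1..n}"

definition state_edges :: "nat \<Rightarrow> braid_word \<Rightarrow> nat set \<Rightarrow> ((nat \<times> nat) \<times> (nat \<times> nat)) set" where
  "state_edges n w S =
     {((t, p), ((t + 1) mod length w, p)) | t p.
         t < length w \<and> p \<in> {1..n} \<and>
         (t \<notin> S \<or> (p \<noteq> fst (w ! t) \<and> p \<noteq> fst (w ! t) + 1))}
   \<union> {((t, fst (w ! t)), (t, fst (w ! t) + 1)) | t. t < length w \<and> t \<in> S}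
   \<union> {(((t + 1) mod length w, fst (w ! t)), ((t + 1) mod length w, fst (w ! t) + 1)) | t.
         t < length w \<and> t \<in> S}"

text \<open>Number of closed loops of the smoothed diagram = number of connected components.\<close>
definition state_loops :: "nat \<Rightarrow> braid_word \<Rightarrow> nat set \<Rightarrow> nat" where
  "state_loops n w S =
     card (closure_points n w // ((state_edges n w S \<union> (state_edges n w S)\<inverse>)\<^sup>*))"

text \<open>Jones polynomial of the closure of the braid word w in B_n, as a Laurent
  polynomial in s = q^{-1/2} (fls_X is s).  With A the Kauffman bracket variable,
  A^2 = s; x_i^{\<epsilon>} contributes A^{-\<epsilon>} (vertical smoothing) or A^{\<epsilon>} (horizontal
  smoothing) and writhe -\<epsilon>; the loop value is d = -A^2 - A^{-2}, and
  V = (-A^3)^{-writhe} <D> / d.  Collecting powers of A gives the formula below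
  (all exponents of A are even).\<close>
definition jones :: "nat \<Rightarrow> braid_word \<Rightarrow> int fls" where
  "jones n w =
     (let m = length w;
          eps = (\<lambda>t. sgn_letter (snd (w ! t)));
          d = - (fls_X + fls_X_inv) :: int fls
      in (if even (\<Sum>t<m. eps t) then 1 else -1) *
         (\<Sum>S\<in>Pow {..<m}.
            fls_X_intpow (\<Sum>t<m. if t \<in> S then 2 * eps t else eps t) *
            d ^ (state_loops n w S - 1)))"

end

theory Submission
  imports Defs Complex_Main "HOL-Computational_Algebra.Polynomial_FPS"
    "HOL-Computational_Algebra.Factorial_Ring" "HOL-Combinatorics.Permutations"
begin

text \<open>Every Laurent polynomial identity may be evaluated at a complex number \<open>z \<noteq> 0\<close>.  Resolving the
  run of \<open>e\<close> equal crossings shows that the value of \<open>V(e)\<close> at \<open>z\<close> is \<open>P (-z)\<^sup>e + Q z\<^bsup>3e\<^esup>\<close> with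
  \<open>P\<close>, \<open>Q\<close> independent of \<open>e\<close>, as soon as the loop value \<open>-z - 1/z\<close> does not vanish.  Let
  \<open>V(a) = V(a + m) = 1\<close> with \<open>m > 0\<close>.

  If \<open>m\<close> is even and \<open>m \<noteq> 2\<close>, take \<open>z = exp(i\<pi>/m)\<close>: then \<open>(-z)\<^sup>m = z\<^bsup>3m\<^esup> = -1\<close>, so the values at \<open>a\<close>
  and \<open>a + m\<close> are opposite, a contradiction.

  If \<open>m\<close> is odd, take \<open>z = -1\<close>: the value of \<open>V(e)\<close> depends only on the parity of \<open>e\<close>, so it is
  always 1.  At \<open>z = -1\<close> the braid generators act on 2-colourings of the strands as
  transpositions, up to a change of signs and of the colours of the even strands.  The value is
  thus half the number of subsets of the strands invariant under the permutation of the braid, and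
  it is 1 iff this permutation is a single cycle.  This cannot hold both for \<open>e = 0\<close> and \<open>e = 1\<close>,
  whose permutations differ by a transposition.\<close>

section \<open>Evaluation of Laurent polynomials at complex numbers\<close>

lemma map_poly_of_int_add:
  "map_poly of_int (p + q) = (map_poly of_int p + map_poly of_int q :: complex poly)"
  by (intro poly_eqI) (simp add: coeff_map_poly)

lemma map_poly_of_int_mult:
  "map_poly of_int (p * q) = (map_poly of_int p * map_poly of_int q :: complex poly)"
  by (intro poly_eqI) (simp add: coeff_map_poly coeff_mult)

lemma map_poly_of_int_power:
  "map_poly of_int (p ^ k) = (map_poly of_int p ^ k :: complex poly)"
  by (induction k) (simp_all add: map_poly_of_int_mult map_poly_1)

text \<open>A Laurent polynomial is a power series in \<open>fls_X\<close> that becomes a polynomial after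
  multiplication by some \<open>fls_X ^ N\<close>; no other Laurent series is related to a value.\<close>

definition fls_eval_rel :: "complex \<Rightarrow> int fls \<Rightarrow> complex \<Rightarrow> bool" where
  "fls_eval_rel z f c \<longleftrightarrow> (\<exists>N p. f * fls_X ^ N = fps_to_fls (fps_of_poly p) \<and>
     c * z ^ N = poly (map_poly of_int p) z)"

lemma fls_X_power_eq_poly: "fls_X ^ N = fps_to_fls (fps_of_poly ([:0, 1:] ^ N :: int poly))"
  by (simp add: fps_of_poly_power fps_of_poly_fps_X fls_X_conv_shift_1 fps_to_fls_power)

text \<open>The power \<open>N\<close> may be enlarged, so two Laurent polynomials can be brought to
  a common power of \<open>fls_X\<close>.\<close>

lemma fls_eval_rel_shift:
  fixes c z :: complex
  assumes "f * fls_X ^ N = fps_to_fls (fps_of_poly p)"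
    and "c * z ^ N = poly (map_poly of_int p) z"
  shows "f * fls_X ^ (N + M) = fps_to_fls (fps_of_poly (p * [:0, 1:] ^ M))"
    and "c * z ^ (N + M) = poly (map_poly of_int (p * [:0, 1:] ^ M)) z"
proof -
  show "f * fls_X ^ (N + M) = fps_to_fls (fps_of_poly (p * [:0, 1:] ^ M))"
    unfolding power_add mult.assoc[symmetric] assms(1) fps_of_poly_mult fls_times_fps_to_fls
    by (simp add: fls_X_power_eq_poly)
  show "c * z ^ (N + M) = poly (map_poly of_int (p * [:0, 1:] ^ M)) z"
    unfolding map_poly_of_int_mult map_poly_of_int_power power_add poly_mult poly_power
    using assms(2) by (simp add: map_poly_pCons flip: mult.assoc)
qed

text \<open>Multiplied by \<open>fls_X ^ (N + M)\<close>, both representations give the same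
  polynomial; the factor \<open>z ^ (N + M)\<close> then cancels because
  \<open>z \<noteq> 0\<close>.\<close>

lemma fls_eval_rel_unique:
  assumes "fls_eval_rel z f c" "fls_eval_rel z f c'" "z \<noteq> 0"
  shows "c = c'"
proof -
  obtain N p where p: "f * fls_X ^ N = fps_to_fls (fps_of_poly p)"
      "c * z ^ N = poly (map_poly of_int p) z"
    using assms(1) unfolding fls_eval_rel_def by blast
  obtain M q where q: "f * fls_X ^ M = fps_to_fls (fps_of_poly q)"
      "c' * z ^ M = poly (map_poly of_int q) z"
    using assms(2) unfolding fls_eval_rel_def by blast
  have "p * [:0, 1:] ^ M = q * [:0, 1:] ^ N"
    using fls_eval_rel_shift(1)[OF p, of M] fls_eval_rel_shift(1)[OF q, of N]
    by (simp add: add.commute fps_of_poly_eq_iff)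
  then have "c * z ^ (N + M) = c' * z ^ (M + N)"
    using fls_eval_rel_shift(2)[OF p, of M] fls_eval_rel_shift(2)[OF q, of N] by simp
  with assms(3) show ?thesis by (simp add: add.commute)
qed

lemma fls_eval_rel_add:
  assumes "fls_eval_rel z f c" "fls_eval_rel z g d"
  shows "fls_eval_rel z (f + g) (c + d)"
proof -
  obtain N p where p: "f * fls_X ^ N = fps_to_fls (fps_of_poly p)"
      "c * z ^ N = poly (map_poly of_int p) z"
    using assms(1) unfolding fls_eval_rel_def by blast
  obtain M q where q: "g * fls_X ^ M = fps_to_fls (fps_of_poly q)"
      "d * z ^ M = poly (map_poly of_int q) z"
    using assms(2) unfolding fls_eval_rel_def by blast
  show ?thesis unfolding fls_eval_rel_def
    using fls_eval_rel_shift[OF p, of M] fls_eval_rel_shift[OF q, of N]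
    by (intro exI[of _ "N + M"] exI[of _ "p * [:0, 1:] ^ M + q * [:0, 1:] ^ N"])
       (simp add: distrib_right add.commute[of M N] fps_of_poly_add map_poly_of_int_add)
qed

lemma fls_eval_rel_mult:
  assumes "fls_eval_rel z f c" "fls_eval_rel z g d"
  shows "fls_eval_rel z (f * g) (c * d)"
proof -
  obtain N p where p: "f * fls_X ^ N = fps_to_fls (fps_of_poly p)"
      "c * z ^ N = poly (map_poly of_int p) z"
    using assms(1) unfolding fls_eval_rel_def by blast
  obtain M q where q: "g * fls_X ^ M = fps_to_fls (fps_of_poly q)"
      "d * z ^ M = poly (map_poly of_int q) z"
    using assms(2) unfolding fls_eval_rel_def by blast
  have "f * g * fls_X ^ (N + M) = (f * fls_X ^ N) * (g * fls_X ^ M)"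
    by (simp add: power_add mult_ac)
  moreover have "c * d * z ^ (N + M) = (c * z ^ N) * (d * z ^ M)"
    by (simp add: power_add mult_ac)
  ultimately show ?thesis unfolding fls_eval_rel_def
    by (intro exI[of _ "N + M"] exI[of _ "p * q"])
       (simp add: p q fps_of_poly_mult fls_times_fps_to_fls map_poly_of_int_mult)
qed

lemma fls_eval_rel_const: "fls_eval_rel z (of_int k) (of_int k)"
  unfolding fls_eval_rel_def
  by (intro exI[of _ 0] exI[of _ "[:k:]"])
     (simp add: map_poly_pCons fls_of_int fps_of_poly_const flip: fls_const_def)

lemma fls_eval_rel_X: "fls_eval_rel z fls_X z"
  unfolding fls_eval_rel_def
  by (intro exI[of _ 0] exI[of _ "[:0, 1:]"])
     (use fls_X_power_eq_poly[of 1] in \<open>simp add: map_poly_pCons\<close>)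

lemma fls_eval_rel_X_inv: "z \<noteq> 0 \<Longrightarrow> fls_eval_rel z fls_X_inv (inverse z)"
  unfolding fls_eval_rel_def
  by (intro exI[of _ 1] exI[of _ "1"])
     (simp add: map_poly_1 fls_X_inv_times_conv_shift)

lemma fls_eval_rel_power: "fls_eval_rel z f c \<Longrightarrow> fls_eval_rel z (f ^ k) (c ^ k)"
  by (induction k) (use fls_eval_rel_const[of z 1] in \<open>simp_all add: fls_eval_rel_mult\<close>)

lemma fls_eval_rel_sum:
  "(\<And>x. x \<in> A \<Longrightarrow> fls_eval_rel z (f x) (g x)) \<Longrightarrow> fls_eval_rel z (sum f A) (sum g A)"
  by (induction A rule: infinite_finite_induct)
     (use fls_eval_rel_const[of z 0] in \<open>simp_all add: fls_eval_rel_add\<close>)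

lemma fls_eval_rel_X_intpow:
  assumes "z \<noteq> 0" shows "fls_eval_rel z (fls_X_intpow k) (z powi k)"
proof (cases "k \<ge> 0")
  case True
  then show ?thesis
    using fls_eval_rel_power[OF fls_eval_rel_X, of z "nat k"]
    by (simp add: power_int_def fls_X_power_conv_shift_1)
next
  case False
  then show ?thesis
    using fls_eval_rel_power[OF fls_eval_rel_X_inv[OF assms], of "nat (- k)"]
    by (simp add: power_int_def fls_X_inv_power_conv_shift_1)
qed

section \<open>Loops of a state and transfer matrices\<close>

text \<open>A subset that is constant along the edges is a union of components, so such subsets
  correspond to the sets of components.\<close>

lemma card_subsets_respecting_edges:
  assumes "finite V" and "E \<subseteq> V \<times> V"
  shows "card {U. U \<subseteq> V \<and> (\<forall>(x, y)\<in>E. x \<in> U \<longleftrightarrow> y \<in> U)} = 2 ^ card (V // ((E \<union> E\<inverse>)\<^sup>*))"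
proof -
  define R where "R = (E \<union> E\<inverse>)\<^sup>*"
  have R: "equiv UNIV R"
    unfolding R_def by (intro equivI refl_rtrancl sym_rtrancl trans_rtrancl)
       (auto simp: sym_def)
  have closed: "y \<in> U" if "(x, y) \<in> R" "x \<in> U" "\<forall>(x, y)\<in>E. x \<in> U \<longleftrightarrow> y \<in> U" for x y U
    using that(1) unfolding R_def by (induction) (use that in auto)
  have RV: "y \<in> V" if "(x, y) \<in> R" "x \<in> V" for x y
    using closed[OF that] assms(2) by auto
  have "bij_betw Union (Pow (V // R)) {U. U \<subseteq> V \<and> (\<forall>(x, y)\<in>E. x \<in> U \<longleftrightarrow> y \<in> U)}"
  proof (rule bij_betw_byWitness[where f' = "\<lambda>U. U // R"])
    show "\<forall>Q\<in>Pow (V // R). \<Union>Q // R = Q"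
    proof
      fix Q assume Q: "Q \<in> Pow (V // R)"
      have eq: "R `` {x} = c" if "c \<in> Q" "x \<in> c" for c x
        using that Q R by (metis Image_singleton_iff PowD equiv_class_eq quotientE subsetD)
      show "\<Union>Q // R = Q"
      proof
        show "\<Union>Q // R \<subseteq> Q" using eq by (auto elim!: quotientE)
        show "Q \<subseteq> \<Union>Q // R"
        proof
          fix c assume c: "c \<in> Q"
          then obtain x where "c = R `` {x}" using Q by (auto elim!: quotientE)
          then have "x \<in> c" using equiv_class_self[OF R] by simp
          then show "c \<in> \<Union>Q // R" using c eq by (metis UnionI quotientI)
        qed
      qed
    qed
    show "\<forall>U\<in>{U. U \<subseteq> V \<and> (\<forall>(x, y)\<in>E. (x \<in> U) = (y \<in> U))}. \<Union> (U // R) = U"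
      using R closed by (auto simp: quotient_def) (metis UNIV_I equiv_class_self Image_singleton_iff)
    show "Union ` Pow (V // R) \<subseteq> {U. U \<subseteq> V \<and> (\<forall>(x, y)\<in>E. (x \<in> U) = (y \<in> U))}"
    proof (rule image_subsetI)
      fix Q assume Q: "Q \<in> Pow (V // R)"
      have "x \<in> c \<longleftrightarrow> y \<in> c" if "c \<in> Q" "(x, y) \<in> E" for c x y
      proof -
        obtain v where "c = R `` {v}" using Q \<open>c \<in> Q\<close> by (auto elim!: quotientE)
        moreover have "(x, y) \<in> R" "(y, x) \<in> R" using that unfolding R_def by auto
        ultimately show ?thesis unfolding R_def by (auto intro: rtrancl_trans)
      qed
      then have "\<forall>(x, y)\<in>E. x \<in> \<Union>Q \<longleftrightarrow> y \<in> \<Union>Q" by blast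
      moreover have "\<Union>Q \<subseteq> V" using Q RV by (fastforce elim!: quotientE)
      ultimately show "\<Union>Q \<in> {U. U \<subseteq> V \<and> (\<forall>(x, y)\<in>E. (x \<in> U) = (y \<in> U))}" by blast
    qed
    show "(\<lambda>U. U // R) ` {U. U \<subseteq> V \<and> (\<forall>(x, y)\<in>E. (x \<in> U) = (y \<in> U))} \<subseteq> Pow (V // R)"
      by (auto simp: quotient_def)
  qed
  moreover have "finite (V // R)" using assms(1) by (auto simp: quotient_def)
  ultimately show ?thesis
    unfolding R_def[symmetric] by (simp only: card_Pow flip: bij_betw_same_card)
qed

section \<open>Colourings of levels and their transfer matrices\<close>

text \<open>A smoothed word lists \<open>None\<close> for the identity and \<open>Some i\<close> for the Temperley-Lieb element
  \<open>e\<^sub>i\<close>.  A set of strands is a 2-colouring of a level, and \<open>level_rel\<close> says that the colourings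
  above and below a smoothed crossing are constant along its arcs.\<close>

fun level_rel :: "nat option \<Rightarrow> nat set \<Rightarrow> nat set \<Rightarrow> bool" where
  "level_rel None f g \<longleftrightarrow> f = g"
| "level_rel (Some i) f g \<longleftrightarrow> (i \<in> f \<longleftrightarrow> i + 1 \<in> f) \<and> (i \<in> g \<longleftrightarrow> i + 1 \<in> g) \<and>
     (\<forall>p. p \<noteq> i \<longrightarrow> p \<noteq> i + 1 \<longrightarrow> (p \<in> f \<longleftrightarrow> p \<in> g))"

text \<open>Strands outside \<open>{1..n}\<close> lie in neither colouring, so only those inside
  have to be compared; this is the form in which \<open>state_edges\<close> lists its
  conditions.\<close>

lemma level_rel_if:
  assumes "f \<subseteq> {1..n}" "g \<subseteq> {1..n}"
  shows "level_rel (if s then Some i else None) f g \<longleftrightarrow>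
    (\<forall>p\<in>{1..n}. \<not> s \<or> p \<noteq> i \<and> p \<noteq> i + 1 \<longrightarrow> (p \<in> f \<longleftrightarrow> p \<in> g)) \<and>
    (s \<longrightarrow> (i \<in> f \<longleftrightarrow> i + 1 \<in> f) \<and> (i \<in> g \<longleftrightarrow> i + 1 \<in> g))"
proof (cases s)
  case True
  have "p \<notin> {1..n} \<Longrightarrow> (p \<in> f \<longleftrightarrow> p \<in> g)" for p using assms by blast
  with True show ?thesis by (simp only: level_rel.simps if_True simp_thms Ball_def) metis
next
  case False
  then show ?thesis using assms by auto
qed

text \<open>An entry of the product of the 0-1 transfer matrices \<open>level_rel x\<close>, whose
  rows and columns are indexed by the 2-colourings of the strands.\<close>

primrec walks :: "nat \<Rightarrow> nat option list \<Rightarrow> nat set \<Rightarrow> nat set \<Rightarrow> nat" where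
  "walks n [] f g = of_bool (f = g)"
| "walks n (x # xs) f g = (\<Sum>h\<in>Pow {1..n}. of_bool (level_rel x f h) * walks n xs h g)"

text \<open>The trace of that product: the last level is glued to the first, as in the closure of a
  braid.\<close>

definition closed_walks :: "nat \<Rightarrow> nat option list \<Rightarrow> nat" where
  "closed_walks n xs = (\<Sum>f\<in>Pow {1..n}. walks n xs f f)"

definition smoothing :: "braid_word \<Rightarrow> nat set \<Rightarrow> nat option list" where
  "smoothing w S = map (\<lambda>t. if t \<in> S then Some (fst (w ! t)) else None) [0..<length w]"

lemma length_smoothing [simp]: "length (smoothing w S) = length w"
  by (simp add: smoothing_def)

text \<open>Expanding the nested sums lists the colourings of all levels except the last one, which
  \<open>cs @ [g]\<close> restores.\<close>

lemma walks_eq_card: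
  assumes "f \<in> Pow {1..n}" "g \<in> Pow {1..n}"
  shows "walks n xs f g = card {cs. length cs = length xs \<and> set cs \<subseteq> Pow {1..n} \<and>
    hd (cs @ [g]) = f \<and>
    (\<forall>t<length xs. level_rel (xs ! t) ((cs @ [g]) ! t) ((cs @ [g]) ! Suc t))}"
  using assms(1)
proof (induction xs arbitrary: f)
  case Nil
  have "{cs. length cs = length ([] :: nat option list) \<and> set cs \<subseteq> Pow {1..n} \<and> hd (cs @ [g]) = f \<and>
      (\<forall>t<length []. level_rel ([] ! t) ((cs @ [g]) ! t) ((cs @ [g]) ! Suc t))} =
      (if f = g then {[]} else {})" by auto
  then show ?case by simp
next
  case (Cons x xs)
  let ?C = "\<lambda>xs f. {cs. length cs = length xs \<and> set cs \<subseteq> Pow {1..n} \<and>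
    hd (cs @ [g]) = f \<and>
    (\<forall>t<length xs. level_rel (xs ! t) ((cs @ [g]) ! t) ((cs @ [g]) ! Suc t))}"
  let ?H = "{h \<in> Pow {1..n}. level_rel x f h}"
  have fin: "finite (?C xs h)" for h
    by (rule finite_subset[OF _ finite_lists_length_eq[of "Pow {1..n}" "length xs"]]) auto
  have C: "?C (x # xs) f = (\<Union>h\<in>?H. (#) f ` ?C xs h)"
  proof (intro set_eqI iffI)
    fix cs assume cs: "cs \<in> ?C (x # xs) f"
    then obtain cs' where cs': "cs = f # cs'" by (cases cs) auto
    have "hd (cs' @ [g]) = (cs' @ [g]) ! 0" by (simp add: hd_conv_nth)
    moreover have "hd (cs' @ [g]) \<in> Pow {1..n}" using cs cs' assms(2) by (cases cs') auto
    ultimately have "hd (cs' @ [g]) \<in> ?H" using cs cs' by auto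
    moreover have "cs' \<in> ?C xs (hd (cs' @ [g]))" using cs cs' by auto
    ultimately show "cs \<in> (\<Union>h\<in>?H. (#) f ` ?C xs h)" using cs' by blast
  next
    fix cs assume "cs \<in> (\<Union>h\<in>?H. (#) f ` ?C xs h)"
    then obtain h cs' where cs': "cs = f # cs'" "cs' \<in> ?C xs h" "h \<in> ?H" by blast
    have "hd (cs' @ [g]) = (cs' @ [g]) ! 0" by (simp add: hd_conv_nth)
    then show "cs \<in> ?C (x # xs) f"
      using cs' Cons.prems by (auto simp: nth_Cons less_Suc_eq_0_disj)
  qed
  have "card (?C (x # xs) f) = (\<Sum>h\<in>?H. card ((#) f ` ?C xs h))"
    unfolding C by (rule card_UN_disjoint) (use fin in auto)
  also have "\<dots> = (\<Sum>h\<in>?H. walks n xs h g)"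
    by (rule sum.cong) (use Cons.IH in \<open>auto simp: card_image\<close>)
  also have "\<dots> = (\<Sum>h\<in>Pow {1..n}. if level_rel x f h then walks n xs h g else 0)"
    by (rule sum.inter_filter) simp
  also have "\<dots> = walks n (x # xs) f g"
    unfolding walks.simps by (rule sum.cong) auto
  finally show ?case by simp
qed

lemma closed_walks_eq_card:
  assumes "xs \<noteq> []"
  shows "closed_walks n xs = card {cs. length cs = length xs \<and> set cs \<subseteq> Pow {1..n} \<and>
    (\<forall>t<length xs. level_rel (xs ! t) (cs ! t) (cs ! (Suc t mod length xs)))}"
    (is "_ = card ?D")
proof -
  let ?C = "\<lambda>f. {cs. length cs = length xs \<and> set cs \<subseteq> Pow {1..n} \<and>
    hd (cs @ [f]) = f \<and>
    (\<forall>t<length xs. level_rel (xs ! t) ((cs @ [f]) ! t) ((cs @ [f]) ! Suc t))}"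
  have fin: "finite (?C h)" for h
    by (rule finite_subset[OF _ finite_lists_length_eq[of "Pow {1..n}" "length xs"]]) auto
  have hd: "hd (cs @ [f]) = hd cs" if "length cs = length xs" for cs and f :: "nat set"
    using that assms by (cases cs) auto
  have "(cs @ [hd cs]) ! Suc t = cs ! (Suc t mod length xs) \<and> (cs @ [hd cs]) ! t = cs ! t"
    if "length cs = length xs" "t < length xs" for cs :: "nat set list" and t
  proof -
    have "hd cs = cs ! 0" using that by (intro hd_conv_nth) auto
    then show ?thesis using that by (cases "Suc t = length xs") (auto simp: nth_append)
  qed
  note nth = this
  have D: "?D = (\<Union>f\<in>Pow {1..n}. ?C f)"
  proof (intro set_eqI iffI)
    fix cs assume cs: "cs \<in> ?D"
    then have "cs \<noteq> []" using assms by auto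
    then have "hd cs \<in> Pow {1..n}" using cs hd_in_set[of cs] by blast
    moreover have "cs \<in> ?C (hd cs)" using cs nth[of cs] hd[of cs "hd cs"] by simp
    ultimately show "cs \<in> (\<Union>f\<in>Pow {1..n}. ?C f)" by blast
  next
    fix cs assume "cs \<in> (\<Union>f\<in>Pow {1..n}. ?C f)"
    then obtain f where cs: "cs \<in> ?C f" by blast
    then have "f = hd cs" using hd[of cs f] by simp
    then show "cs \<in> ?D" using cs nth[of cs] by simp
  qed
  show ?thesis unfolding closed_walks_def D
    by (subst card_UN_disjoint) (use fin hd in \<open>auto simp: walks_eq_card\<close>)
qed

text \<open>Cutting a set of diagram points into levels gives a cyclic sequence of colourings, and
  the three families of edges at a crossing together express \<open>level_rel\<close> there.\<close>

lemma card_respecting_eq_closed_walks: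
  assumes "\<forall>x\<in>set w. fst x \<in> {1..n - 1}" and "w \<noteq> []"
  shows "card {U. U \<subseteq> closure_points n w \<and> (\<forall>(x, y)\<in>state_edges n w S. x \<in> U \<longleftrightarrow> y \<in> U)}
    = closed_walks n (smoothing w S)"
proof -
  define m where "m = length w"
  let ?L = "\<lambda>U t. {p. (t, p) \<in> U}"
  have m: "m > 0" using assms(2) by (simp add: m_def)
  \<comment> \<open>The facts \<open>ball_pairs\<close> and \<open>regroup\<close> turn the three
    set comprehensions of \<open>state_edges\<close> into one condition per crossing.\<close>
  have ball_pairs:
    "(\<forall>(x, y)\<in>{(a t p, b t p) | t p. Q t p}. R x y) \<longleftrightarrow> (\<forall>t p. Q t p \<longrightarrow> R (a t p) (b t p))"
    "(\<forall>(x, y)\<in>{(a' t, b' t) | t. Q' t}. R x y) \<longleftrightarrow> (\<forall>t. Q' t \<longrightarrow> R (a' t) (b' t))"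
    for R :: "nat \<times> nat \<Rightarrow> nat \<times> nat \<Rightarrow> bool" and a b a' b' and Q :: "nat \<Rightarrow> nat \<Rightarrow> bool" and Q'
    by blast+
  have regroup: "((\<forall>t p. t < m \<and> p \<in> P \<and> K t p \<longrightarrow> R t p) \<and> (\<forall>t. t < m \<and> t \<in> S \<longrightarrow> A t)) \<and>
      (\<forall>t. t < m \<and> t \<in> S \<longrightarrow> B t) \<longleftrightarrow>
      (\<forall>t<m. (\<forall>p\<in>P. K t p \<longrightarrow> R t p) \<and> (t \<in> S \<longrightarrow> A t \<and> B t))"
    for P :: "nat set" and K R A B by blast
  have compat: "(\<forall>(x, y)\<in>state_edges n w S. x \<in> U \<longleftrightarrow> y \<in> U) \<longleftrightarrow>
    (\<forall>t<m. level_rel (smoothing w S ! t) (?L U t) (?L U (Suc t mod m)))"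
    if U: "U \<subseteq> {0..<m} \<times> {1..n}" for U
  proof -
    have "(\<forall>(x, y)\<in>state_edges n w S. x \<in> U \<longleftrightarrow> y \<in> U) \<longleftrightarrow>
      (\<forall>t<m. (\<forall>p\<in>{1..n}. t \<notin> S \<or> (p \<noteq> fst (w ! t) \<and> p \<noteq> fst (w ! t) + 1) \<longrightarrow>
           ((t, p) \<in> U \<longleftrightarrow> (Suc t mod m, p) \<in> U)) \<and>
         (t \<in> S \<longrightarrow> ((t, fst (w ! t)) \<in> U \<longleftrightarrow> (t, fst (w ! t) + 1) \<in> U) \<and>
           ((Suc t mod m, fst (w ! t)) \<in> U \<longleftrightarrow> (Suc t mod m, fst (w ! t) + 1) \<in> U)))"
      unfolding state_edges_def m_def[symmetric] ball_Un ball_pairs Suc_eq_plus1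
      by (rule regroup)
    also have "\<dots> \<longleftrightarrow> (\<forall>t<m. level_rel (smoothing w S ! t) (?L U t) (?L U (Suc t mod m)))"
    proof (intro arg_cong[of _ _ All] ext imp_cong refl)
      fix t assume t: "t < m"
      have in_n: "p \<in> {1..n}" if "(t, p) \<in> U \<or> (Suc t mod m, p) \<in> U" for p
        using that U by auto
      show "((\<forall>p\<in>{1..n}. t \<notin> S \<or> (p \<noteq> fst (w ! t) \<and> p \<noteq> fst (w ! t) + 1) \<longrightarrow>
           ((t, p) \<in> U \<longleftrightarrow> (Suc t mod m, p) \<in> U)) \<and>
         (t \<in> S \<longrightarrow> ((t, fst (w ! t)) \<in> U \<longleftrightarrow> (t, fst (w ! t) + 1) \<in> U) \<and>
           ((Suc t mod m, fst (w ! t)) \<in> U \<longleftrightarrow> (Suc t mod m, fst (w ! t) + 1) \<in> U)))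
        \<longleftrightarrow> level_rel (smoothing w S ! t) (?L U t) (?L U (Suc t mod m))"
      proof -
        have "smoothing w S ! t = (if t \<in> S then Some (fst (w ! t)) else None)"
          using t by (simp add: smoothing_def m_def)
        moreover have "?L U t \<subseteq> {1..n}" "?L U (Suc t mod m) \<subseteq> {1..n}" using in_n by auto
        ultimately show ?thesis
          using level_rel_if[of "?L U t" n "?L U (Suc t mod m)" "t \<in> S" "fst (w ! t)"]
          by (simp only: mem_Collect_eq)
      qed
    qed
    finally show ?thesis .
  qed
  have "bij_betw (\<lambda>U. map (?L U) [0..<m])
    {U. U \<subseteq> closure_points n w \<and> (\<forall>(x, y)\<in>state_edges n w S. x \<in> U \<longleftrightarrow> y \<in> U)}
    {cs. length cs = length (smoothing w S) \<and> set cs \<subseteq> Pow {1..n} \<and>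
      (\<forall>t<length (smoothing w S). level_rel (smoothing w S ! t) (cs ! t)
        (cs ! (Suc t mod length (smoothing w S))))}"
    (is "bij_betw ?\<phi> ?A ?B")
  proof (rule bij_betw_byWitness[where f' = "\<lambda>cs. {(t, p). t < m \<and> p \<in> cs ! t}"])
    have pts: "closure_points n w = {0..<m} \<times> {1..n}"
      using m by (simp add: closure_points_def max_def flip: m_def)
    show "\<forall>U\<in>?A. {(t, p). t < m \<and> p \<in> ?\<phi> U ! t} = U"
      unfolding pts by auto
    show "\<forall>cs\<in>?B. ?\<phi> {(t, p). t < m \<and> p \<in> cs ! t} = cs"
      by (auto simp: m_def intro!: nth_equalityI)
    show "?\<phi> ` ?A \<subseteq> ?B"
    proof (rule image_subsetI)
      fix U assume U: "U \<in> ?A"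
      then have "\<forall>t<m. level_rel (smoothing w S ! t) (?L U t) (?L U (Suc t mod m))"
        using compat[of U] unfolding pts by blast
      then show "?\<phi> U \<in> ?B" using U m unfolding pts by (auto simp: m_def[symmetric])
    qed
    show "(\<lambda>cs. {(t, p). t < m \<and> p \<in> cs ! t}) ` ?B \<subseteq> ?A"
    proof (rule image_subsetI)
      fix cs assume cs: "cs \<in> ?B"
      let ?U = "{(t, p). t < m \<and> p \<in> cs ! t}"
      have U: "?U \<subseteq> {0..<m} \<times> {1..n}"
      proof (rule subrelI)
        fix t p assume "(t, p) \<in> ?U"
        then have "t < m" "p \<in> cs ! t" by auto
        moreover from this have "cs ! t \<in> set cs" using cs by (simp add: m_def)
        moreover have "set cs \<subseteq> Pow {1..n}" using cs by blast
        ultimately have "p \<in> {1..n}" by blast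
        with \<open>t < m\<close> show "(t, p) \<in> {0..<m} \<times> {1..n}" by simp
      qed
      have "?L ?U t = cs ! t" if "t < m" for t using that by auto
      then have "\<forall>t<m. level_rel (smoothing w S ! t) (?L ?U t) (?L ?U (Suc t mod m))"
        using cs m by (auto simp: m_def[symmetric])
      then show "?U \<in> ?A" using compat[OF U] U unfolding pts by blast
    qed
  qed
  from bij_betw_same_card[OF this] show ?thesis
    using closed_walks_eq_card[of "smoothing w S" n] assms(2)
    by (metis length_smoothing length_0_conv)
qed

lemma state_edges_subset:
  assumes "\<forall>x\<in>set w. fst x \<in> {1..n - 1}"
  shows "state_edges n w S \<subseteq> closure_points n w \<times> closure_points n w"
proof -
  have "fst (w ! t) \<in> {1..n - 1}" if "t < length w" for t
    using assms that nth_mem by blast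
  then have "fst (w ! t) \<in> {1..n} \<and> Suc (fst (w ! t)) \<in> {1..n}" if "t < length w" for t
    using that by fastforce
  moreover have "(t + 1) mod length w < length w" "t < max 1 (length w)" "(t + 1) mod length w < max 1 (length w)"
    if "t < length w" for t
    using that by (auto simp: less_max_iff_disj intro!: mod_less_divisor)
  ultimately show ?thesis
    unfolding state_edges_def closure_points_def by auto
qed

text \<open>The sets of points that respect the edges are counted twice, by components and by closed
  walks. In the empty word each strand closes to a loop of its own.\<close>

lemma power_state_loops:
  assumes "\<forall>x\<in>set w. fst x \<in> {1..n - 1}"
  shows "2 ^ state_loops n w S = closed_walks n (smoothing w S)"
proof (cases "w = []")
  case True
  have "state_loops n w S = n"
    by (simp add: True state_loops_def state_edges_def closure_points_def quotient_def
        UNION_singleton_eq_range card_image card_cartesian_product flip: Id_def)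
  moreover have "closed_walks n (smoothing w S) = 2 ^ n"
    by (simp add: closed_walks_def True smoothing_def card_Pow)
  ultimately show ?thesis by simp
next
  case False
  have "finite (closure_points n w)" by (simp add: closure_points_def)
  from card_subsets_respecting_edges[OF this state_edges_subset[OF assms]] show ?thesis
    unfolding state_loops_def using card_respecting_eq_closed_walks[OF assms False] by simp
qed

section \<open>Composition and Temperley-Lieb relations of walks\<close>

lemma walks_append:
  "f \<in> Pow {1..n} \<Longrightarrow> walks n (xs @ ys) f g = (\<Sum>h\<in>Pow {1..n}. walks n xs f h * walks n ys h g)"
proof (induction xs arbitrary: f)
  case Nil
  have "(\<Sum>h\<in>Pow {1..n}. of_bool (f = h) * walks n ys h g) = (\<Sum>h\<in>{f}. walks n ys h g)"
    by (rule sum.mono_neutral_cong_right) (use Nil in auto)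
  then show ?case by simp
next
  case (Cons x xs)
  then have "walks n ((x # xs) @ ys) f g = (\<Sum>h'\<in>Pow {1..n}. \<Sum>h\<in>Pow {1..n}.
      of_bool (level_rel x f h') * (walks n xs h' h * walks n ys h g))"
    by (simp add: sum_distrib_left del: Pow_iff)
  also have "\<dots> = (\<Sum>h\<in>Pow {1..n}. walks n (x # xs) f h * walks n ys h g)"
    by (subst sum.swap) (simp add: sum_distrib_right mult.assoc)
  finally show ?case .
qed

lemma walks_None:
  assumes "f \<in> Pow {1..n}"
  shows "walks n (None # ys) f g = walks n ys f g"
  using walks_append[OF assms, of "[]" ys g]
  by (simp only: walks.simps level_rel.simps append_Nil)

text \<open>The relation \<open>e_i^2 = d e_i\<close> at loop value \<open>d = 2\<close>: the
  colouring between the two elements is forced off the strands \<open>i\<close> and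
  \<open>i + 1\<close>, where it takes either of the two constant colours.\<close>

lemma walks_Some_Some:
  assumes "f \<in> Pow {1..n}" "i \<in> {1..n - 1}"
  shows "walks n (Some i # Some i # ys) f g = 2 * walks n (Some i # ys) f g"
proof -
  have TT: "(\<Sum>h\<in>Pow {1..n}. of_bool (level_rel (Some i) f h) * of_bool (level_rel (Some i) h k))
     = 2 * (of_bool (level_rel (Some i) f k) :: nat)" for k
  proof (cases "level_rel (Some i) f k")
    case True
    have "{h \<in> Pow {1..n}. level_rel (Some i) f h \<and> level_rel (Some i) h k} =
        {f \<union> {i, i + 1}, f - {i, i + 1}}" (is "?A = ?B")
    proof
      show "?A \<subseteq> ?B"
      proof
        fix h assume h: "h \<in> ?A"
        then have "(if i \<in> h then h = f \<union> {i, i + 1} else h = f - {i, i + 1})"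
          by (auto split: if_splits)
        then show "h \<in> ?B" by (auto split: if_splits)
      qed
      show "?B \<subseteq> ?A" using True assms by auto
    qed
    moreover have "f \<union> {i, i + 1} \<noteq> f - {i, i + 1}" by blast
    ultimately have "card {h \<in> Pow {1..n}. level_rel (Some i) f h \<and> level_rel (Some i) h k} = 2"
      by simp
    then show ?thesis using True
      by (simp add: Int_def flip: of_bool_conj del: level_rel.simps)
  next
    case False
    then have "\<not> (level_rel (Some i) f h \<and> level_rel (Some i) h k)" for h
      by auto
    then show ?thesis using False by (auto simp del: level_rel.simps simp flip: of_bool_conj)
  qed
  have "walks n (Some i # Some i # ys) f g = (\<Sum>k\<in>Pow {1..n}.
      (\<Sum>h\<in>Pow {1..n}. of_bool (level_rel (Some i) f h) * of_bool (level_rel (Some i) h k)) *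
      walks n ys k g)"
    unfolding walks.simps sum_distrib_left sum_distrib_right mult.assoc by (rule sum.swap)
  then show ?thesis unfolding TT walks.simps sum_distrib_left mult.assoc .
qed

lemma closed_walks_None: "closed_walks n (xs @ None # ys) = closed_walks n (xs @ ys)"
  unfolding closed_walks_def
  by (intro sum.cong refl) (simp add: walks_append walks_None del: walks.simps Pow_iff)

lemma closed_walks_Some_Some:
  assumes "i \<in> {1..n - 1}"
  shows "closed_walks n (xs @ Some i # Some i # ys) = 2 * closed_walks n (xs @ Some i # ys)"
  unfolding closed_walks_def
  by (simp add: walks_append walks_Some_Some[OF _ assms] sum_distrib_left mult_ac
      del: walks.simps Pow_iff)

section \<open>The state sum along a power of a generator\<close>

text \<open>The weight \<open>F\<close> of a smoothed word is left free, so that one block of a word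
  can be expanded while the rest is held fixed. The sign coming from the writhe is added
  separately.\<close>

definition state_sum :: "complex \<Rightarrow> braid_word \<Rightarrow> (nat option list \<Rightarrow> complex) \<Rightarrow> complex" where
  "state_sum z w F = (\<Sum>S\<in>Pow {..<length w}.
     z powi (\<Sum>t<length w. if t \<in> S then 2 * sgn_letter (snd (w ! t)) else sgn_letter (snd (w ! t))) *
     F (smoothing w S))"

lemma state_sum_Nil [simp]: "state_sum z [] F = F []"
  by (simp add: state_sum_def smoothing_def)

lemma state_sum_linear:
  "state_sum z w (\<lambda>xs. a * F xs + b * G xs) = a * state_sum z w F + b * state_sum z w G"
  by (simp add: state_sum_def algebra_simps sum.distrib sum_distrib_left)

lemma state_sum_sum:
  "state_sum z w (\<lambda>xs. \<Sum>k\<in>K. F k xs) = (\<Sum>k\<in>K. state_sum z w (F k))"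
  by (simp add: state_sum_def sum_distrib_left sum.swap[of _ K])

lemma state_sum_cmult:
  "state_sum z w (\<lambda>xs. a * F xs) = a * state_sum z w F"
  using state_sum_linear[of z w a F 0 F] by simp

lemma state_sum_commute:
  "state_sum z u (\<lambda>xs. state_sum z v (\<lambda>ys. F xs ys)) =
   state_sum z v (\<lambda>ys. state_sum z u (\<lambda>xs. F xs ys))"
  unfolding state_sum_def sum_distrib_left by (subst sum.swap) (simp add: mult_ac)

text \<open>A state either omits or contains the last position. This resolves the last crossing into
  the identity with weight \<open>q\<close> and \<open>e_i\<close> with weight \<open>q^2\<close>,
  where \<open>q = z powi sgn_letter b\<close>.\<close>

lemma state_sum_snoc:
  assumes "z \<noteq> 0"
  shows "state_sum z (w @ [(i, b)]) F =
    z powi sgn_letter b * state_sum z w (\<lambda>xs. F (xs @ [None])) +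
    (z powi sgn_letter b)\<^sup>2 * state_sum z w (\<lambda>xs. F (xs @ [Some i]))"
proof -
  define m where "m = length w"
  define wt where "wt S t = (if t \<in> S then 2 * sgn_letter (snd ((w @ [(i, b)]) ! t))
    else sgn_letter (snd ((w @ [(i, b)]) ! t)))" for S t
  define T where "T S = z powi (\<Sum>t<Suc m. wt S t) * F (smoothing (w @ [(i, b)]) S)" for S
  have "state_sum z (w @ [(i, b)]) F = sum T (Pow {..<Suc m})"
    by (simp add: state_sum_def T_def wt_def m_def del: sum.lessThan_Suc)
  also have "Pow {..<Suc m} = Pow {..<m} \<union> insert m ` Pow {..<m}"
    by (simp add: lessThan_Suc Pow_insert)
  also have "sum T \<dots> = sum T (Pow {..<m}) + sum T (insert m ` Pow {..<m})"
    by (rule sum.union_disjoint) auto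
  also have "sum T (insert m ` Pow {..<m}) = (\<Sum>S\<in>Pow {..<m}. T (insert m S))"
    by (rule sum.reindex_cong[OF _ refl refl]) (auto simp: inj_on_def)
  also have "sum T (Pow {..<m}) = z powi sgn_letter b * state_sum z w (\<lambda>xs. F (xs @ [None]))"
    unfolding state_sum_def sum_distrib_left
  proof (rule sum.cong)
    fix S assume S: "S \<in> Pow {..<length w}"
    have "smoothing (w @ [(i, b)]) S = smoothing w S @ [None]"
      using S by (auto simp: smoothing_def nth_append)
    moreover have "(\<Sum>t<Suc m. wt S t) = sgn_letter b +
        (\<Sum>t<m. if t \<in> S then 2 * sgn_letter (snd (w ! t)) else sgn_letter (snd (w ! t)))"
      using S by (auto simp: wt_def m_def nth_append intro!: sum.cong)
    ultimately show "T S = z powi sgn_letter b * (z powi (\<Sum>t<length w. if t \<in> S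
        then 2 * sgn_letter (snd (w ! t)) else sgn_letter (snd (w ! t))) * F (smoothing w S @ [None]))"
      using assms by (simp add: T_def power_int_add m_def del: sum.lessThan_Suc)
  qed (simp add: m_def)
  also have "(\<Sum>S\<in>Pow {..<m}. T (insert m S)) =
      (z powi sgn_letter b)\<^sup>2 * state_sum z w (\<lambda>xs. F (xs @ [Some i]))"
    unfolding state_sum_def sum_distrib_left
  proof (rule sum.cong)
    fix S assume S: "S \<in> Pow {..<length w}"
    have "smoothing (w @ [(i, b)]) (insert m S) = smoothing w S @ [Some i]"
      using S by (auto simp: smoothing_def nth_append m_def)
    moreover have "(\<Sum>t<Suc m. wt (insert m S) t) = 2 * sgn_letter b +
        (\<Sum>t<m. if t \<in> S then 2 * sgn_letter (snd (w ! t)) else sgn_letter (snd (w ! t)))"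
      by (auto simp: wt_def m_def nth_append intro!: sum.cong)
    moreover have "z powi (2 * sgn_letter b) = (z powi sgn_letter b)\<^sup>2"
      by (simp add: sgn_letter_def power_int_minus power_inverse)
    ultimately show "T (insert m S) = (z powi sgn_letter b)\<^sup>2 * (z powi (\<Sum>t<length w. if t \<in> S
        then 2 * sgn_letter (snd (w ! t)) else sgn_letter (snd (w ! t))) * F (smoothing w S @ [Some i]))"
      using assms by (simp add: T_def power_int_add m_def del: sum.lessThan_Suc)
  qed (simp add: m_def)
  finally show ?thesis .
qed

lemma state_sum_append:
  assumes "z \<noteq> 0"
  shows "state_sum z (u @ v) F = state_sum z u (\<lambda>xs. state_sum z v (\<lambda>ys. F (xs @ ys)))"
proof (induction v arbitrary: F rule: rev_induct)
  case (snoc x v)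
  obtain i b where x: "x = (i, b)" by (cases x)
  show ?case
    by (simp add: x state_sum_snoc[OF assms] snoc state_sum_linear flip: append_assoc)
qed simp

text \<open>With its sign a crossing acts as \<open>-(q + q^2 e_i)\<close>, and
  \<open>e_i / d\<close> is idempotent. The eigenvalues are therefore \<open>- q\<close> on the
  kernel of \<open>e_i\<close> and \<open>-(q + q^2 d) = q^3\<close> on its image; the two summands
  are the two eigenparts.\<close>

lemma state_sum_replicate:
  fixes F :: "nat option list \<Rightarrow> complex"
  assumes "z \<noteq> 0" and "d \<noteq> 0" and d: "d = - (z + inverse z)"
    and None: "\<And>us vs. F (us @ None # vs) = F (us @ vs)"
    and Some: "\<And>us vs. F (us @ Some i # Some i # vs) = d * F (us @ Some i # vs)"
  shows "(-1) ^ m * state_sum z (replicate m (i, b)) (\<lambda>rs. F (xs @ rs @ ys)) =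
    (- (z powi sgn_letter b)) ^ m * (F (xs @ ys) - F (xs @ Some i # ys) / d) +
    (z powi sgn_letter b) ^ (3 * m) * (F (xs @ Some i # ys) / d)"
proof (induction m arbitrary: ys)
  case (Suc m)
  define q where "q = z powi sgn_letter b"
  \<comment> \<open>The eigenvalue on the image of \<open>e_i\<close>. Both kinds of crossing are
    covered because \<open>d\<close> is symmetric in \<open>z\<close> and
    \<open>inverse z\<close>.\<close>
  have q: "q * (1 + q * d) = - (q ^ 3)"
    using assms(1) by (cases b) (auto simp: q_def d sgn_letter_def field_simps power3_eq_cube)
  define A B where "A = F (xs @ ys)" and "B = F (xs @ Some i # ys)"
  have 1: "(-1) ^ m * state_sum z (replicate m (i, b)) (\<lambda>rs. F (xs @ rs @ ys)) =
      (- q) ^ m * (A - B / d) + q ^ (3 * m) * (B / d)"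
    using Suc[of ys] by (simp add: q_def A_def B_def)
  \<comment> \<open>Here \<open>F (xs @ Some i # Some i # ys) / d = B\<close>, so the first
    eigenpart cancels.\<close>
  have 2: "(-1) ^ m * state_sum z (replicate m (i, b)) (\<lambda>rs. F (xs @ rs @ Some i # ys)) =
      q ^ (3 * m) * B"
    using Suc[of "Some i # ys"] assms(2) by (simp add: q_def B_def Some)
  have "(-1) ^ Suc m * state_sum z (replicate (Suc m) (i, b)) (\<lambda>rs. F (xs @ rs @ ys)) =
    - q * ((-1) ^ m * state_sum z (replicate m (i, b)) (\<lambda>rs. F (xs @ rs @ ys))) -
    q\<^sup>2 * ((-1) ^ m * state_sum z (replicate m (i, b)) (\<lambda>rs. F (xs @ rs @ Some i # ys)))"
    unfolding replicate_Suc replicate_append_same[symmetric] state_sum_snoc[OF assms(1)]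
    using None[of "xs @ _" ys] by (simp add: q_def algebra_simps)
  also have "\<dots> = (- q) ^ Suc m * (A - B / d) - q ^ (3 * m) * (q * (1 + q * d)) * (B / d)"
    unfolding 1 2 using assms(2) by (simp add: field_simps power2_eq_square)
  also have "\<dots> = (- q) ^ Suc m * (A - B / d) + q ^ (3 * Suc m) * (B / d)"
    unfolding q by (simp add: power_add)
  finally show ?case by (simp only: q_def A_def B_def)
qed simp

section \<open>Values of the Jones polynomial\<close>

text \<open>The number of closed walks is a power of 2, whose exponent is the number of loops.\<close>

definition loop_count :: "nat \<Rightarrow> nat option list \<Rightarrow> nat" where
  "loop_count n xs = multiplicity 2 (closed_walks n xs)"

text \<open>The empty colouring on every level is a closed walk. Positivity is what makes the
  multiplicity of 2 grow by one under doubling.\<close>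

lemma closed_walks_pos: "closed_walks n xs > 0"
proof -
  have "walks n xs {} {} > 0"
  proof (induction xs)
    case (Cons x xs)
    have "level_rel x {} {}" by (cases x) auto
    then have "(\<exists>h\<in>Pow {1..n}. of_bool (level_rel x {} h) * walks n xs h {} > 0)"
      using Cons by (intro bexI[of _ "{}"]) auto
    then show ?case by (simp only: walks.simps) (meson finite_Pow_iff finite_atLeastAtMost sum_pos2 zero_le)
  qed simp
  then show ?thesis
    unfolding closed_walks_def by (intro sum_pos2[of _ "{}"]) auto
qed

lemma loop_count_None: "loop_count n (xs @ None # ys) = loop_count n (xs @ ys)"
  by (simp add: loop_count_def closed_walks_None)

lemma loop_count_Some_Some:
  "i \<in> {1..n - 1} \<Longrightarrow>
    loop_count n (xs @ Some i # Some i # ys) = Suc (loop_count n (xs @ Some i # ys))"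
  using closed_walks_pos[of n "xs @ Some i # ys"]
  by (simp only: loop_count_def closed_walks_Some_Some) (subst multiplicity_times_same, auto)

lemma loop_count_smoothing:
  assumes "\<forall>x\<in>set w. fst x \<in> {1..n - 1}"
  shows "loop_count n (smoothing w S) = state_loops n w S"
  unfolding loop_count_def power_state_loops[OF assms, symmetric]
  by (rule multiplicity_same_power) auto

lemma state_loops_pos:
  assumes "n \<ge> 1" shows "state_loops n w S > 0"
proof -
  have "finite (closure_points n w // R)" "closure_points n w // R \<noteq> {}" for R
    using assms by (auto simp: quotient_def closure_points_def less_max_iff_disj)
  then show ?thesis by (simp add: state_loops_def card_gt_0_iff)
qed

text \<open>One division by the loop value replaces the truncated exponent
  \<open>state_loops n w S - 1\<close>, so that the weight of a smoothed word is multiplicative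
  under a doubled \<open>Some i\<close>.\<close>

definition jones_at :: "nat \<Rightarrow> complex \<Rightarrow> braid_word \<Rightarrow> complex" where
  "jones_at n z w = (-1) ^ length w *
     state_sum z w (\<lambda>xs. (- (z + inverse z)) ^ loop_count n xs) / (- (z + inverse z))"

lemma even_sum_of_odd_iff:
  fixes f :: "nat \<Rightarrow> int"
  assumes "\<And>t. odd (f t)" shows "even (\<Sum>t<m. f t) \<longleftrightarrow> even m"
  by (induction m) (use assms in auto)

lemma fls_eval_rel_jones:
  assumes "n \<ge> 1" and w: "\<forall>x\<in>set w. fst x \<in> {1..n - 1}"
    and "z \<noteq> 0" and d: "z + inverse z \<noteq> 0"
  shows "fls_eval_rel z (jones n w) (jones_at n z w)"
proof -
  define dz where "dz = - (z + inverse z)"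
  let ?e = "\<lambda>S. \<Sum>t<length w. if t \<in> S then 2 * sgn_letter (snd (w ! t)) else sgn_letter (snd (w ! t))"
  have dX: "fls_eval_rel z (- (fls_X + fls_X_inv)) dz"
    using fls_eval_rel_mult[OF fls_eval_rel_const[of z "-1"]
        fls_eval_rel_add[OF fls_eval_rel_X fls_eval_rel_X_inv[OF assms(3)]]]
    by (simp add: dz_def)
  have "dz \<noteq> 0" using d unfolding dz_def by (simp only: neg_equal_0_iff_equal) simp
  \<comment> \<open>There is at least one loop, so the truncated subtraction is exact.\<close>
  then have pw: "dz ^ (state_loops n w S - 1) = dz ^ loop_count n (smoothing w S) / dz" for S
    using state_loops_pos[OF assms(1), of w S]
    by (cases "state_loops n w S") (auto simp: loop_count_smoothing[OF w])
  \<comment> \<open>Every crossing sign is odd, so the writhe and the number of crossings have the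
    same parity.\<close>
  have sgn: "(if even (\<Sum>t<length w. sgn_letter (snd (w ! t))) then 1 else -1 :: int fls) =
      of_int ((-1) ^ length w)"
    by (simp add: even_sum_of_odd_iff sgn_letter_def)
  have "fls_eval_rel z (jones n w) (of_int ((-1) ^ length w) *
      (\<Sum>S\<in>Pow {..<length w}. z powi ?e S * dz ^ (state_loops n w S - 1)))"
    unfolding jones_def Let_def sgn
    by (intro fls_eval_rel_mult fls_eval_rel_const fls_eval_rel_sum fls_eval_rel_power dX
        fls_eval_rel_X_intpow assms(3))
  also have "of_int ((-1) ^ length w) *
      (\<Sum>S\<in>Pow {..<length w}. z powi ?e S * dz ^ (state_loops n w S - 1)) = jones_at n z w"
    unfolding jones_at_def state_sum_def dz_def[symmetric] pw
    by (simp flip: sum_divide_distrib)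
  finally show ?thesis .
qed

lemma jones_at_eq_1:
  assumes "n \<ge> 1" and "\<forall>x\<in>set w. fst x \<in> {1..n - 1}"
    and "z \<noteq> 0" and "z + inverse z \<noteq> 0" and "jones n w = 1"
  shows "jones_at n z w = 1"
  using fls_eval_rel_unique[OF fls_eval_rel_jones[OF assms(1-4)] _ assms(3), of 1]
    fls_eval_rel_const[of z 1] assms(5) by simp

text \<open>For fixed states outside the run, \<open>state_sum_replicate\<close> splits its
  contribution into two eigenparts; summing these over the outside states gives \<open>P\<close> and
  \<open>Q\<close>.\<close>

lemma jones_at_power:
  assumes "i \<in> {1..n - 1}" and z: "z \<noteq> 0" and d: "z + inverse z \<noteq> 0"
  obtains P Q where "\<And>e. jones_at n z (u @ replicate (nat \<bar>e\<bar>) (i, e > 0) @ v) =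
    P * (- z) powi e + Q * z powi (3 * e)"
proof -
  define dz where "dz = - (z + inverse z)"
  have dz: "dz \<noteq> 0" using d unfolding dz_def by (simp only: neg_equal_0_iff_equal) simp
  define F where "F xs = dz ^ loop_count n xs" for xs
  define c where "c = (-1) ^ (length u + length v) / dz"
  define A where "A xs ys = F (xs @ ys) - F (xs @ Some i # ys) / dz" for xs ys
  define B where "B xs ys = F (xs @ Some i # ys) / dz" for xs ys
  define P where "P = c * state_sum z u (\<lambda>xs. state_sum z v (\<lambda>ys. A xs ys))"
  define Q where "Q = c * state_sum z u (\<lambda>xs. state_sum z v (\<lambda>ys. B xs ys))"
  have "jones_at n z (u @ replicate (nat \<bar>e\<bar>) (i, e > 0) @ v) =
    P * (- z) powi e + Q * z powi (3 * e)" for e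
  proof -
    let ?m = "nat \<bar>e\<bar>" and ?q = "z powi sgn_letter (e > 0)"
    \<comment> \<open>For \<open>e \<le> 0\<close> the run consists of \<open>nat (- e)\<close>
      letters with \<open>?q = inverse z\<close>, so these natural powers become integer powers of
      \<open>- z\<close> and \<open>z\<close>.\<close>
    have q1: "(- ?q) ^ ?m = (- z) powi e"
      by (auto simp: sgn_letter_def power_int_def power_inverse simp flip: inverse_minus_eq)
    have q2: "?q ^ (3 * ?m) = z powi (3 * e)"
    proof (cases "e > 0")
      case False
      then have "nat (- (3 * e)) = 3 * nat (- e)" by simp
      with False show ?thesis by (simp add: sgn_letter_def power_int_def power_inverse)
    qed (simp add: sgn_letter_def power_int_def nat_mult_distrib)
    have run: "(-1) ^ ?m * state_sum z (replicate ?m (i, e > 0)) (\<lambda>rs. F (xs @ rs @ ys)) =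
        (- z) powi e * A xs ys + z powi (3 * e) * B xs ys" for xs ys
      unfolding A_def B_def q1[symmetric] q2[symmetric]
      by (rule state_sum_replicate[OF z dz dz_def])
         (simp_all add: F_def loop_count_None loop_count_Some_Some[OF assms(1)])
    \<comment> \<open>The sum over the run is moved inside the sum over \<open>v\<close>, so that
      \<open>run\<close> applies with both sides fixed.\<close>
    have "jones_at n z (u @ replicate ?m (i, e > 0) @ v) = c * ((-1) ^ ?m *
        state_sum z u (\<lambda>xs. state_sum z v (\<lambda>ys.
          state_sum z (replicate ?m (i, e > 0)) (\<lambda>rs. F (xs @ rs @ ys)))))"
      unfolding jones_at_def dz_def[symmetric] F_def[symmetric] state_sum_append[OF z]
      by (subst state_sum_commute[of z v]) (simp add: c_def power_add)
    also have "\<dots> = c * state_sum z u (\<lambda>xs. state_sum z v (\<lambda>ys.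
        (- z) powi e * A xs ys + z powi (3 * e) * B xs ys))"
      by (simp only: state_sum_cmult flip: run)
    finally show ?thesis
      unfolding state_sum_linear P_def Q_def by (simp only: distrib_left mult_ac)
  qed
  then show thesis by (rule that)
qed

section \<open>The value at $s = -1$\<close>

definition braid_perm :: "braid_word \<Rightarrow> nat \<Rightarrow> nat" where
  "braid_perm w = fold (\<lambda>x p. transpose (fst x) (fst x + 1) \<circ> p) w id"

lemma braid_perm_Nil [simp]: "braid_perm [] = id"
  by (simp add: braid_perm_def)

lemma braid_perm_snoc [simp]:
  "braid_perm (w @ [x]) = transpose (fst x) (fst x + 1) \<circ> braid_perm w"
  by (simp add: braid_perm_def)

lemma braid_perm_append: "braid_perm (u @ v) = braid_perm v \<circ> braid_perm u"
  by (induction v rule: rev_induct) (simp_all add: comp_assoc flip: append_assoc)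

lemma braid_perm_permutes:
  assumes "\<forall>x\<in>set w. fst x \<in> {1..n - 1}"
  shows "braid_perm w permutes {1..n}"
  using assms
proof (induction w rule: rev_induct)
  case (snoc x w)
  then have "fst x \<in> {1..n}" "fst x + 1 \<in> {1..n}" by auto
  moreover have "braid_perm w permutes {1..n}" using snoc by simp
  ultimately show ?case unfolding braid_perm_snoc by (intro permutes_compose permutes_swap_id)
qed (simp add: permutes_id)

text \<open>Exchanging the two colours on the even strands only turns equal colours on adjacent
  strands into opposite ones.\<close>

definition flip_even :: "nat \<Rightarrow> nat set \<Rightarrow> nat set" where
  "flip_even n f = {p \<in> {1..n}. p \<in> f \<longleftrightarrow> odd p}"

text \<open>The diagonal change of signs that makes the crossing matrices at \<open>z = -1\<close>
  permutation matrices.\<close>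

definition even_sign :: "nat set \<Rightarrow> complex" where
  "even_sign f = (-1) ^ card {p \<in> f. even p}"

lemma even_sign_square: "even_sign f * even_sign f = 1"
  by (simp add: even_sign_def flip: power_mult_distrib)

lemma flip_even_in: "flip_even n f \<in> Pow {1..n}"
  by (auto simp: flip_even_def)

lemma flip_even_flip_even: "f \<in> Pow {1..n} \<Longrightarrow> flip_even n (flip_even n f) = f"
  by (auto simp: flip_even_def)

lemma flip_even_eq_iff:
  "f \<in> Pow {1..n} \<Longrightarrow> g \<in> Pow {1..n} \<Longrightarrow> flip_even n f = flip_even n g \<longleftrightarrow> f = g"
  by (metis flip_even_flip_even)

lemma bij_betw_flip_even: "bij_betw (flip_even n) (Pow {1..n}) (Pow {1..n})"
  by (rule bij_betw_byWitness[where f' = "flip_even n"])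
     (use flip_even_flip_even flip_even_in in blast)+

text \<open>Exactly one of two adjacent strands is even, and the swap moves the single chosen strand
  of the pair onto or off it.\<close>

lemma even_sign_swap:
  assumes k: "finite k" and i: "i \<in> k \<longleftrightarrow> i + 1 \<notin> k"
  shows "even_sign (transpose i (i + 1) ` k) = - even_sign k"
proof -
  define e where "e = (if even i then i else i + 1)"
  let ?E = "{p \<in> k. even p}" and ?E' = "{p \<in> transpose i (i + 1) ` k. even p}"
  have mem: "p \<in> transpose i (i + 1) ` k \<longleftrightarrow> transpose i (i + 1) p \<in> k" for p
    by (simp add: in_transpose_image_iff)
  have e: "e \<in> ?E' \<longleftrightarrow> e \<notin> ?E" unfolding mem_Collect_eq mem using i by (auto simp: e_def)
  have ne: "p \<in> ?E' \<longleftrightarrow> p \<in> ?E" if "p \<noteq> e" for p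
    unfolding mem_Collect_eq mem using that by (auto simp: e_def transpose_def split: if_splits)
  have ins: "A = insert e B" if "e \<in> A" "\<And>p. p \<noteq> e \<Longrightarrow> p \<in> A \<longleftrightarrow> p \<in> B" for A B
  proof (rule set_eqI)
    show "p \<in> A \<longleftrightarrow> p \<in> insert e B" for p by (cases "p = e") (simp_all add: that)
  qed
  show ?thesis
  proof (cases "e \<in> ?E")
    case True
    then have e': "e \<notin> ?E'" using e by blast
    moreover have "?E = insert e ?E'" using True ne by (intro ins) blast+
    ultimately show ?thesis using k by (simp add: even_sign_def)
  next
    case False
    then have "?E' = insert e ?E" using e ne by (intro ins) blast+
    then show ?thesis using k False by (simp add: even_sign_def)
  qed
qed

text \<open>At \<open>z = -1\<close> a crossing acts, up to sign, as \<open>1 - e_i\<close>. After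
  the colour change \<open>e_i\<close> relates only colourings with opposite colours on
  \<open>i\<close> and \<open>i + 1\<close>. On these \<open>1 - e_i\<close> is minus the swap, and
  \<open>even_sign\<close> absorbs the minus; on the others it is the identity and the swap fixes
  the colouring.\<close>

lemma flipped_level_rel:
  assumes "k \<in> Pow {1..n}" "g \<in> Pow {1..n}" "i \<in> {1..n - 1}"
  shows "even_sign k * (of_bool (k = g) - of_bool (level_rel (Some i) (flip_even n k) (flip_even n g)))
    = even_sign g * of_bool (transpose i (i + 1) ` k = g)"
proof -
  let ?t = "transpose i (i + 1) ` k"
  have in_n: "i \<in> {1..n}" "i + 1 \<in> {1..n}" using assms(3) by auto
  have flip: "p \<in> flip_even n f \<longleftrightarrow> (p \<in> f \<longleftrightarrow> odd p)" if "p \<in> {1..n}" for p f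
    using that by (auto simp: flip_even_def)
  have flip_out: "p \<notin> f \<and> p \<notin> flip_even n f" if "p \<notin> {1..n}" "f \<in> Pow {1..n}" for p f
    using that by (auto simp: flip_even_def)
  have off: "(p \<in> flip_even n k \<longleftrightarrow> p \<in> flip_even n g) \<longleftrightarrow> (p \<in> k \<longleftrightarrow> p \<in> g)" for p
    using flip[of p k] flip[of p g] flip_out[of p k] flip_out[of p g] assms by (cases "p \<in> {1..n}") auto
  have lr: "level_rel (Some i) (flip_even n k) (flip_even n g) \<longleftrightarrow>
     (i \<in> k \<longleftrightarrow> i + 1 \<notin> k) \<and> (i \<in> g \<longleftrightarrow> i + 1 \<notin> g) \<and>
     (\<forall>p. p \<noteq> i \<longrightarrow> p \<noteq> i + 1 \<longrightarrow> (p \<in> k \<longleftrightarrow> p \<in> g))"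
    unfolding level_rel.simps off flip[OF in_n(1)] flip[OF in_n(2)] by auto
  have mem: "p \<in> ?t \<longleftrightarrow> (if p = i then i + 1 \<in> k else if p = i + 1 then i \<in> k else p \<in> k)" for p
    by (auto simp: in_transpose_image_iff transpose_def)
  show ?thesis
  proof (cases "i \<in> k \<longleftrightarrow> i + 1 \<notin> k")
    case False
    then have "?t = k" using mem by (intro set_eqI) (auto split: if_splits)
    moreover have "\<not> level_rel (Some i) (flip_even n k) (flip_even n g)" using lr False by blast
    ultimately show ?thesis by (cases "k = g") (auto simp del: level_rel.simps)
  next
    case True
    have tk: "?t \<noteq> k" using mem[of i] True by auto
    have "level_rel (Some i) (flip_even n k) (flip_even n g) \<longleftrightarrow> g = k \<or> g = ?t"
    proof
      assume *: "level_rel (Some i) (flip_even n k) (flip_even n g)"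
      show "g = k \<or> g = ?t"
      proof (cases "i \<in> g \<longleftrightarrow> i \<in> k")
        case T: True
        then have "p \<in> g \<longleftrightarrow> p \<in> k" for p using * lr True by metis
        then show ?thesis by blast
      next
        case F: False
        then have "p \<in> g \<longleftrightarrow> p \<in> ?t" for p unfolding mem using * lr True by metis
        then show ?thesis by blast
      qed
    next
      assume "g = k \<or> g = ?t"
      then show "level_rel (Some i) (flip_even n k) (flip_even n g)"
      proof
        assume "g = k"
        then show ?thesis unfolding lr using True by blast
      next
        assume g: "g = ?t"
        show ?thesis unfolding lr unfolding g mem using True by auto
      qed
    qed
    moreover have "even_sign ?t = - even_sign k"
      using True assms(1) finite_subset by (intro even_sign_swap) auto
    ultimately show ?thesis using tk by (cases "g = k"; cases "g = ?t") auto
  qed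
qed

lemma walks_snoc:
  assumes "f \<in> Pow {1..n}" "g \<in> Pow {1..n}"
  shows "walks n (xs @ [x]) f g = (\<Sum>h\<in>Pow {1..n}. walks n xs f h * of_bool (level_rel x h g))"
proof -
  have "walks n [x] h g = of_bool (level_rel x h g)" for h
  proof -
    have "walks n [x] h g = (\<Sum>k\<in>Pow {1..n}. if k = g then of_bool (level_rel x h g) else 0)"
      unfolding walks.simps by (rule sum.cong) auto
    then show ?thesis using assms(2) by simp
  qed
  then show ?thesis by (simp only: walks_append[OF assms(1)])
qed

text \<open>In the product of the crossing matrices the intermediate signs cancel, which leaves a
  permutation matrix with the signs of its two end colourings.\<close>

lemma state_sum_walks:
  assumes "f \<in> Pow {1..n}" "g \<in> Pow {1..n}" "\<forall>x\<in>set w. fst x \<in> {1..n - 1}"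
  shows "(-1) ^ length w * state_sum (-1) w
      (\<lambda>xs. of_nat (walks n xs (flip_even n f) (flip_even n g))) =
    even_sign f * even_sign g * of_bool (braid_perm w ` f = g)"
  using assms(2,3)
proof (induction w arbitrary: g rule: rev_induct)
  case Nil
  then show ?case using assms(1) even_sign_square[of f] by (auto simp: flip_even_eq_iff)
next
  case (snoc x w)
  obtain i b where x: "x = (i, b)" by (cases x)
  have i: "i \<in> {1..n - 1}" using snoc.prems x by auto
  let ?\<phi> = "flip_even n" and ?\<pi> = "braid_perm w"
  define Z where "Z h = (-1) ^ length w * state_sum (-1) w
    (\<lambda>xs. of_nat (walks n xs (?\<phi> f) h))" for h
  have Z: "Z (?\<phi> h) = even_sign f * even_sign h * of_bool (?\<pi> ` f = h)" if "h \<in> Pow {1..n}" for h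
    unfolding Z_def using snoc.IH[OF that] snoc.prems by simp
  have step: "(-1) ^ length w * state_sum (-1) w
      (\<lambda>xs. of_nat (walks n (xs @ [y]) (?\<phi> f) (?\<phi> g))) =
      (\<Sum>h\<in>Pow {1..n}. Z h * of_bool (level_rel y h (?\<phi> g)))" for y
    unfolding walks_snoc[OF flip_even_in flip_even_in] of_nat_sum state_sum_sum sum_distrib_left Z_def
    by (simp only: of_nat_mult of_nat_of_bool mult.commute[of _ "of_bool _"] state_sum_cmult)
       (simp only: mult_ac)
  have "?\<pi> permutes {1..n}" using snoc.prems by (intro braid_perm_permutes) simp
  then have img: "?\<pi> ` f \<in> Pow {1..n}"
    using assms(1) permutes_image by blast
  have "(-1) ^ length (w @ [x]) * state_sum (-1) (w @ [x])
      (\<lambda>xs. of_nat (walks n xs (?\<phi> f) (?\<phi> g))) =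
    (\<Sum>h\<in>Pow {1..n}. Z h * of_bool (level_rel None h (?\<phi> g))) -
    (\<Sum>h\<in>Pow {1..n}. Z h * of_bool (level_rel (Some i) h (?\<phi> g)))"
    unfolding step[symmetric] by (cases b) (simp_all add: x state_sum_snoc sgn_letter_def algebra_simps)
  also have "\<dots> = (\<Sum>h\<in>Pow {1..n}. Z h * (of_bool (h = ?\<phi> g) - of_bool (level_rel (Some i) h (?\<phi> g))))"
    by (simp only: right_diff_distrib sum_subtractf level_rel.simps)
  \<comment> \<open>The intermediate colourings are listed through \<open>flip_even\<close>, the
    form in which the induction hypothesis gives \<open>Z\<close>.\<close>
  also have "\<dots> = (\<Sum>h\<in>Pow {1..n}. Z (?\<phi> h) *
      (of_bool (?\<phi> h = ?\<phi> g) - of_bool (level_rel (Some i) (?\<phi> h) (?\<phi> g))))"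
    by (rule sum.reindex_bij_betw[OF bij_betw_flip_even, symmetric])
  also have "\<dots> = (\<Sum>h\<in>Pow {1..n}. if h = ?\<pi> ` f then even_sign f * (even_sign h *
      (of_bool (h = g) - of_bool (level_rel (Some i) (?\<phi> h) (?\<phi> g)))) else 0)"
  proof (rule sum.cong)
    fix h assume h: "h \<in> Pow {1..n}"
    show "Z (?\<phi> h) * (of_bool (?\<phi> h = ?\<phi> g) - of_bool (level_rel (Some i) (?\<phi> h) (?\<phi> g))) =
      (if h = ?\<pi> ` f then even_sign f * (even_sign h *
      (of_bool (h = g) - of_bool (level_rel (Some i) (?\<phi> h) (?\<phi> g)))) else 0)"
    proof (cases "h = ?\<pi> ` f")
      case False
      then have "?\<pi> ` f \<noteq> h" by blast
      with False show ?thesis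
        by (simp only: Z[OF h] if_False of_bool_eq mult_zero_left mult_zero_right)
    next
      case True
      show ?thesis
        by (simp only: Z[OF h] flip_even_eq_iff[OF h snoc.prems(1)] True[symmetric] of_bool_eq
            if_True simp_thms mult_1_left mult.assoc)
    qed
  qed simp
  also have "\<dots> = even_sign f * (even_sign (?\<pi> ` f) *
      (of_bool (?\<pi> ` f = g) - of_bool (level_rel (Some i) (?\<phi> (?\<pi> ` f)) (?\<phi> g))))"
    using img by (simp del: level_rel.simps)
  also have "\<dots> = even_sign f * even_sign g * of_bool (braid_perm (w @ [x]) ` f = g)"
    unfolding flipped_level_rel[OF img snoc.prems(1) i] by (simp add: x image_comp)
  finally show ?case .
qed

text \<open>The loop value is 2, so loop weights count closed walks and the state sum is a trace;
  the factor 2 undoes the division by the loop value. On the diagonal the end signs cancel, and the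
  trace of a permutation matrix counts fixed points.\<close>

lemma jones_at_minus_1:
  assumes w: "\<forall>x\<in>set w. fst x \<in> {1..n - 1}"
  shows "2 * jones_at n (-1) w = of_nat (card {f \<in> Pow {1..n}. braid_perm w ` f = f})"
proof -
  have pw: "(- ((-1) + inverse (-1))) ^ loop_count n (smoothing w S) =
      (of_nat (closed_walks n (smoothing w S)) :: complex)" for S
    by (simp add: loop_count_smoothing[OF w] flip: power_state_loops[OF w])
  have "2 * jones_at n (-1) w = (-1) ^ length w * state_sum (-1) w (\<lambda>xs. of_nat (closed_walks n xs))"
    unfolding jones_at_def state_sum_def pw by simp
  also have "(\<lambda>xs. of_nat (closed_walks n xs) :: complex) =
      (\<lambda>xs. \<Sum>f\<in>Pow {1..n}. of_nat (walks n xs (flip_even n f) (flip_even n f)))"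
    unfolding closed_walks_def of_nat_sum
    by (rule ext, rule sum.reindex_bij_betw[OF bij_betw_flip_even, symmetric])
  also have "(-1) ^ length w * state_sum (-1) w \<dots> =
      (\<Sum>f\<in>Pow {1..n}. of_bool (braid_perm w ` f = f))"
    unfolding state_sum_sum sum_distrib_left
    by (rule sum.cong) (simp_all add: state_sum_walks[OF _ _ w] even_sign_square)
  also have "\<dots> = of_nat (card {f \<in> Pow {1..n}. braid_perm w ` f = f})"
    by (simp add: Int_def)
  finally show ?thesis .
qed

text \<open>Composing a single cycle with a transposition of two of its points cuts it in two: the
  arc from \<open>p y\<close> to \<open>x\<close> closes up, and it omits \<open>y\<close>.\<close>

lemma not_both_single_cycle:
  assumes p: "p permutes A" and "finite A" and xy: "x \<in> A" "y \<in> A" "x \<noteq> y"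
    and inv: "\<And>f. f \<subseteq> A \<Longrightarrow> p ` f = f \<Longrightarrow> f = {} \<or> f = A"
    and inv': "\<And>f. f \<subseteq> A \<Longrightarrow> (p \<circ> transpose x y) ` f = f \<Longrightarrow> f = {} \<or> f = A"
  shows False
proof -
  have stable: "q ` f = f" if "inj q" "q ` f \<subseteq> f" "f \<subseteq> A" for f and q :: "'a \<Rightarrow> 'a"
    using that \<open>finite A\<close> by (meson endo_inj_surj finite_subset inj_on_subset subset_UNIV)
  have "inj p" using p by (rule permutes_inj)
  have orb: "(p ^^ k) y \<in> A" for k
    by (induction k) (use xy p in \<open>auto simp: permutes_in_image\<close>)
  \<comment> \<open>The orbit of \<open>y\<close> is nonempty and invariant, hence all of
    \<open>A\<close>, so it reaches \<open>x\<close>.\<close>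
  have "p ` range (\<lambda>k. (p ^^ k) y) \<subseteq> range (\<lambda>k. (p ^^ k) y)"
    by (auto intro: range_eqI[where x = "Suc _"])
  then have "range (\<lambda>k. (p ^^ k) y) = A"
    using inv stable[OF \<open>inj p\<close>] orb by (metis (no_types, lifting) image_is_empty image_subset_iff UNIV_not_empty)
  then obtain k0 where "(p ^^ k0) y = x" using xy by (metis (mono_tags) imageE)
  define k where "k = (LEAST k. (p ^^ k) y = x)"
  have k: "(p ^^ k) y = x" unfolding k_def by (rule LeastI) fact
  have least: "(p ^^ j) y \<noteq> x" if "j < k" for j using that not_less_Least unfolding k_def by blast
  have "k > 0" using k xy by (cases k) auto
  define f where "f = (\<lambda>j. (p ^^ j) y) ` {1..k}"
  \<comment> \<open>A return to \<open>y\<close> after \<open>j\<close> steps would bring the first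
    visit to \<open>x\<close> forward to step \<open>k - j\<close>.\<close>
  have y: "y \<notin> f"
  proof
    assume "y \<in> f"
    then obtain j where j: "1 \<le> j" "j \<le> k" "(p ^^ j) y = y" unfolding f_def by auto
    have "(p ^^ (k - j)) ((p ^^ j) y) = (p ^^ k) y"
      using j by (metis comp_apply funpow_add le_add_diff_inverse2)
    then show False using j k least[of "k - j"] by simp
  qed
  have "(p \<circ> transpose x y) ` f \<subseteq> f"
  proof
    fix v assume "v \<in> (p \<circ> transpose x y) ` f"
    then obtain j where j: "1 \<le> j" "j \<le> k" "v = p (transpose x y ((p ^^ j) y))" unfolding f_def by auto
    show "v \<in> f"
    proof (cases "(p ^^ j) y = x")
      case True
      then have "v = (p ^^ 1) y" using j by simp
      then show ?thesis unfolding f_def using \<open>k > 0\<close> by (intro image_eqI[of _ _ 1]) auto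
    next
      case False
      have "(p ^^ j) y \<noteq> y" using y j unfolding f_def by force
      then have "v = (p ^^ Suc j) y" using False j by simp
      moreover have "j \<noteq> k" using False k by auto
      ultimately show ?thesis unfolding f_def using j by (intro image_eqI[of _ _ "Suc j"]) auto
    qed
  qed
  moreover have fA: "f \<subseteq> A" using orb unfolding f_def by auto
  moreover have "inj (p \<circ> transpose x y)" using \<open>inj p\<close> by (intro inj_compose) auto
  ultimately have "f = {} \<or> f = A" by (intro inv' stable)
  then show False using y xy \<open>k > 0\<close> unfolding f_def by auto
qed

text \<open>The value 1 leaves exactly two invariant subsets, and \<open>{}\<close> and
  \<open>{1..n}\<close> are already two.\<close>

lemma invariant_subset_trivial:
  assumes "n \<ge> 1" and w: "\<forall>x\<in>set w. fst x \<in> {1..n - 1}" and "jones_at n (-1) w = 1"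
    and f: "f \<subseteq> {1..n}" "braid_perm w ` f = f"
  shows "f = {} \<or> f = {1..n}"
proof (rule ccontr)
  assume "\<not> ?thesis"
  then have ne: "f \<noteq> {}" "f \<noteq> {1..n}" by auto
  moreover have "{1..n} \<noteq> {}" using assms(1) by simp
  ultimately have "card {{}, {1..n}, f} = 3"
    using ne[symmetric] by (simp add: card_insert_if del: atLeastatMost_empty_iff atLeastatMost_empty_iff2)
  moreover have "{{}, {1..n}, f} \<subseteq> {f \<in> Pow {1..n}. braid_perm w ` f = f}"
    using f permutes_image[OF braid_perm_permutes[OF w]] by auto
  then have "card {{}, {1..n}, f} \<le> card {f \<in> Pow {1..n}. braid_perm w ` f = f}"
    by (intro card_mono) auto
  moreover have "of_nat (card {f \<in> Pow {1..n}. braid_perm w ` f = f}) = (of_nat 2 :: complex)"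
    using jones_at_minus_1[OF w] assms(3) by simp
  then have "card {f \<in> Pow {1..n}. braid_perm w ` f = f} = 2"
    by (simp only: of_nat_eq_iff)
  ultimately show False by simp
qed

text \<open>Inserting one crossing composes the permutation with a transposition, so the two
  permutations cannot both be single cycles.\<close>

lemma jones_at_minus_1_adjacent:
  assumes "n \<ge> 1" and u: "\<forall>x\<in>set u. fst x \<in> {1..n - 1}" and v: "\<forall>x\<in>set v. fst x \<in> {1..n - 1}"
    and i: "i \<in> {1..n - 1}"
    and 0: "jones_at n (-1) (u @ v) = 1" and 1: "jones_at n (-1) (u @ [(i, b)] @ v) = 1"
  shows False
proof -
  have uv: "\<forall>x\<in>set (u @ v). fst x \<in> {1..n - 1}" "\<forall>x\<in>set (u @ [(i, b)] @ v). fst x \<in> {1..n - 1}"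
    using u v i by auto
  let ?p = "braid_perm (u @ v)" and ?q = "inv (braid_perm u)"
  have pu: "braid_perm u permutes {1..n}" by (rule braid_perm_permutes[OF u])
  \<comment> \<open>Moving the transposition past \<open>braid_perm u\<close> conjugates it into the
    transposition of the preimages of \<open>i\<close> and \<open>i + 1\<close>.\<close>
  have "braid_perm u (transpose (?q i) (?q (i + 1)) x) = transpose i (i + 1) (braid_perm u x)" for x
    using permutes_inverses[OF pu] by (metis transpose_apply_first transpose_apply_other transpose_apply_second)
  then have swap: "braid_perm (u @ [(i, b)] @ v) = ?p \<circ> transpose (?q i) (?q (i + 1))"
    using braid_perm_snoc[of u "(i, b)"]
    by (simp only: append_assoc[symmetric] braid_perm_append) (simp add: braid_perm_append fun_eq_iff)
  have "?q i \<in> {1..n}" "?q (i + 1) \<in> {1..n}" "?q i \<noteq> ?q (i + 1)"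
    using i permutes_in_image[OF permutes_inv[OF pu]] permutes_inj[OF permutes_inv[OF pu]]
    by (auto dest: injD)
  then show False
  proof (rule not_both_single_cycle[OF braid_perm_permutes[OF uv(1)], rotated])
    show "f = {} \<or> f = {1..n}" if "f \<subseteq> {1..n}" "?p ` f = f" for f
      by (rule invariant_subset_trivial[OF assms(1) uv(1) 0 that])
    show "f = {} \<or> f = {1..n}" if "f \<subseteq> {1..n}" "(?p \<circ> transpose (?q i) (?q (i + 1))) ` f = f" for f
      by (rule invariant_subset_trivial[OF assms(1) uv(2) 1 that(1)]) (simp only: swap that(2))
  qed simp
qed

section \<open>Trivial values along a power of a generator\<close>

lemma braid_of_powers_append: "braid_of_powers (ps @ qs) = braid_of_powers ps @ braid_of_powers qs"
  by (simp add: braid_of_powers_def)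

lemma braid_of_powers_Cons:
  "braid_of_powers ((i, e) # ps) = replicate (nat \<bar>e\<bar>) (i, e > 0) @ braid_of_powers ps"
  by (simp add: braid_of_powers_def)

lemma set_braid_of_powers: "fst ` set (braid_of_powers ps) \<subseteq> fst ` set ps"
  by (force simp: braid_of_powers_def)

lemma jones_power_eq_1_diff:
  fixes a b :: int
  assumes "n \<ge> 1" and i: "i \<in> {1..n - 1}"
    and u: "\<forall>x\<in>set u. fst x \<in> {1..n - 1}" and v: "\<forall>x\<in>set v. fst x \<in> {1..n - 1}"
    and W: "\<And>e. W e = u @ replicate (nat \<bar>e\<bar>) (i, e > 0) @ v"
    and a: "jones n (W a) = 1" and b: "jones n (W b) = 1" and "a < b"
  shows "b - a = 2"
proof (rule ccontr)
  assume ne: "b - a \<noteq> 2"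
  have valid: "\<forall>x\<in>set (W e). fst x \<in> {1..n - 1}" for e
    using u v i by (auto simp: W)
  have at1: "jones_at n z (W e) = 1" if "z \<noteq> 0" "z + inverse z \<noteq> 0" "e = a \<or> e = b" for z e
    using jones_at_eq_1[OF assms(1) valid that(1,2)] that(3) a b by auto
  show False
  proof (cases "even (b - a)")
    case True
    define m where "m = b - a"
    define t where "t = pi / of_int m"
    define z where "z = cis t"
    \<comment> \<open>An even \<open>m\<close> other than 2 is at least 4, so the angle lies below
      \<open>pi / 2\<close> and the loop value is nonzero. For \<open>m = 2\<close> the point
      \<open>z\<close> would be the imaginary unit, where it vanishes.\<close>
    have m: "m \<ge> 4" "even m" using True ne \<open>a < b\<close> unfolding m_def by presburger+
    then have "0 < t" "t < pi / 2" by (auto simp: t_def field_simps)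
    then have "cos t > 0" by (intro cos_gt_zero_pi) auto
    then have "Re (z + inverse z) > 0" by (simp add: z_def flip: cis_inverse)
    then have d: "z + inverse z \<noteq> 0" by (metis less_irrefl zero_complex.sel(1))
    have z: "z \<noteq> 0" by (simp add: z_def)
    have zm: "z powi m = -1"
      using m by (simp add: z_def cis_power_int t_def flip: cis_pi)
    obtain P Q where PQ: "\<And>e. jones_at n z (W e) = P * (- z) powi e + Q * z powi (3 * e)"
      using jones_at_power[OF i z d, of u v] unfolding W by blast
    have "jones_at n z (W b) = P * (- z) powi (a + m) + Q * z powi (3 * a + m * 3)"
      unfolding PQ m_def by (simp add: algebra_simps)
    also have "\<dots> = - (P * (- z) powi a + Q * z powi (3 * a))"
      using z m zm by (simp add: power_int_add power_int_mult power_int_minus_left_even)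
    also have "\<dots> = - jones_at n z (W a)" unfolding PQ ..
    finally show False using at1[OF z d] by simp
  next
    case False
    obtain P Q where PQ: "\<And>e. jones_at n (-1) (W e) = P * (- (-1)) powi e + Q * (-1) powi (3 * e)"
      using jones_at_power[OF i, of "-1" u v] unfolding W by auto
    \<comment> \<open>At \<open>z = -1\<close> the two powers are 1 and
      \<open>(-1) powi (3 * e)\<close>, so only the parity of \<open>e\<close> enters.\<close>
    have parity: "jones_at n (-1) (W e) = jones_at n (-1) (W e')" if "even e \<longleftrightarrow> even e'" for e e'
      unfolding PQ using that by (cases "even e") auto
    \<comment> \<open>The exponents \<open>a\<close> and \<open>b\<close> have opposite parities, so
      every \<open>e\<close> agrees in parity with one of them.\<close>
    have all_1: "jones_at n (-1) (W e) = 1" for e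
      using parity[of e a] parity[of e b] at1[of "-1"] False by auto
    have "jones_at n (-1) (u @ v) = 1" "jones_at n (-1) (u @ [(i, True)] @ v) = 1"
      using all_1[of 0] all_1[of 1] by (simp_all add: W)
    then show False by (rule jones_at_minus_1_adjacent[OF assms(1) u v i])
  qed
qed

theorem theorem1p7:
  fixes n k j :: nat and i :: "nat \<Rightarrow> nat" and a :: "nat \<Rightarrow> int"
  assumes "n \<ge> 2" and "k \<ge> 1"
    and "\<forall>h\<in>{1..k}. i h \<in> {1..n - 1}"
    and "j \<in> {1..k}"
  defines "V \<equiv> (\<lambda>e::int. jones n (braid_of_powers
              (map (\<lambda>h. (i h, if h = j then e else a h)) [1..<k + 1])))"
  shows "finite {e. V e = 1} \<and> card {e. V e = 1} \<le> 2 \<and>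
         (\<forall>a' b'. V a' = 1 \<longrightarrow> V b' = 1 \<longrightarrow> a' \<noteq> b' \<longrightarrow> \<bar>a' - b'\<bar> = 2)"
proof -
  define u where "u = braid_of_powers (map (\<lambda>h. (i h, a h)) [1..<j])"
  define v where "v = braid_of_powers (map (\<lambda>h. (i h, a h)) [Suc j..<k + 1])"
  define W where "W e = braid_of_powers (map (\<lambda>h. (i h, if h = j then e else a h)) [1..<k + 1])" for e
  have "[1..<k + 1] = [1..<j] @ j # [Suc j..<k + 1]"
    using assms(4) upt_add_eq_append[of 1 j "k + 1 - j"] by (simp add: upt_conv_Cons)
  moreover have "map (\<lambda>h. (i h, if h = j then e else a h)) [1..<j] = map (\<lambda>h. (i h, a h)) [1..<j]"
    "map (\<lambda>h. (i h, if h = j then e else a h)) [Suc j..<k + 1] = map (\<lambda>h. (i h, a h)) [Suc j..<k + 1]" for e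
    by auto
  ultimately have W: "W e = u @ replicate (nat \<bar>e\<bar>) (i j, e > 0) @ v" for e
    by (simp only: W_def u_def v_def braid_of_powers_append braid_of_powers_Cons
        map_append list.map if_True refl)
  have "fst ` set u \<subseteq> {1..n - 1}" "fst ` set v \<subseteq> {1..n - 1}"
    unfolding u_def v_def by (rule order_trans[OF set_braid_of_powers]; use assms(3,4) in force)+
  then have uv: "\<forall>x\<in>set u. fst x \<in> {1..n - 1}" "\<forall>x\<in>set v. fst x \<in> {1..n - 1}" by auto
  have V: "V e = jones n (W e)" for e by (simp add: V_def W_def)
  have lt: "d - c = 2" if "V c = 1" "V d = 1" "c < d" for c d
    using jones_power_eq_1_diff[OF _ _ uv W, of c d] assms(1,3,4) that V by auto
  then have diff: "\<bar>c - d\<bar> = 2" if "V c = 1" "V d = 1" "c \<noteq> d" for c d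
    using that lt[of c d] lt[of d c] by (cases "c < d") auto
  have "finite {e. V e = 1} \<and> card {e. V e = 1} \<le> 2"
  proof (cases "\<exists>c. V c = 1")
    case True
    then obtain c where c: "V c = 1" by blast
    \<comment> \<open>The least exponent with value 1: it is \<open>c - 2\<close> if that exponent
      qualifies and \<open>c\<close> otherwise, since any two such exponents differ by exactly
      2.\<close>
    obtain c0 where c0: "V c0 = 1" "\<And>e. V e = 1 \<Longrightarrow> c0 \<le> e"
    proof (cases "V (c - 2) = 1")
      case True
      then show thesis using that[of "c - 2"] lt[of _ "c - 2"] lt[of _ c] c by force
    next
      case False
      have "c \<le> e" if "V e = 1" for e
        using lt[of e c] that c False by (metis add_diff_cancel_left' diff_add_cancel linorder_not_le)
      then show thesis using that c by blast
    qed
    have "{e. V e = 1} \<subseteq> {c0, c0 + 2}"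
    proof
      fix e assume "e \<in> {e. V e = 1}"
      then show "e \<in> {c0, c0 + 2}" using lt[of c0 e] c0 by force
    qed
    moreover have "card {c0, c0 + 2} = 2" by simp
    ultimately show ?thesis by (metis card_mono finite.emptyI finite.insertI finite_subset)
  qed simp
  with diff show ?thesis by blast
qed

end
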